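(* An implicative-ortholattice is an implicative-orthomodular lattice if and only if it admits a full Sasaki set of projections.
   Context: A BE algebra is an algebra $(X,\to,1)$ such that for all $x,y,z\in X$: $x\to x=1$; $x\to 1=1$; $1\to x=x$; $x\to(y\to z)=y\to(x\to z)$. It carries the relation $x\le y$ iff $x\to y=1$. It is bounded if there is $0\in X$ with $0\le x$ for all $x\in X$; then $x^*:=x\to 0$ (so $0=1^*$) and the algebra is written $(X,\to,{}^*,1)$. It is involutive if $x^{**}=x$ for all $x$, and implicative if $(x\to y)\to x=x$ for all $x,y$. An implicative-ortholattice is an implicative involutive (bounded) BE algebra. Put $x\wedge_Q y:=((x^*\to y^* )\to y^* )^*$, and $x\le_L y$ iff $x=(x\to y^* )^*$. An implicative-orthomodular lattice is an implicative-ortholattice with $x\wedge_Q(y\to x)=x$ for all $x,y$. A set $S$ of maps $X\to X$ is a Sasaki set of projections on an implicative-ortholattice $X$ if: (1) for each $\varphi\in S$ and all $x,y\in X$, $x\le_L y$ implies $\varphi x\le_L\varphi y$; (2) for $\varphi,\psi\in S$, $\varphi 1\le_L\psi 1$ implies $\varphi\circ\psi=\varphi$; (3) for each $\varphi\in S$ and all $x\in X$, $\varphi((\varphi x)^* )\le_L x^*$. It is full if for each $x\in X$ there exists $\varphi^x\in S$ with $\varphi^x 1=x$. *)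

theory Defs
  imports Main
begin

locale BE_algebra =
  fixes imp :: "'a \<Rightarrow> 'a \<Rightarrow> 'a"  (infixr \<open>\<rightarrow>\<close> 70)
    and one :: 'a  (\<open>\<one>\<close>)
  assumes imp_self: "x \<rightarrow> x = \<one>"
    and imp_one: "x \<rightarrow> \<one> = \<one>"
    and one_imp: "\<one> \<rightarrow> x = x"
    and imp_exchange: "x \<rightarrow> (y \<rightarrow> z) = y \<rightarrow> (x \<rightarrow> z)"
begin

definition le :: "'a \<Rightarrow> 'a \<Rightarrow> bool"  (infix \<open>\<sqsubseteq>\<close> 50)
  where "x \<sqsubseteq> y \<longleftrightarrow> x \<rightarrow> y = \<one>"

end

text \<open>
  The relation \<open>\<sqsubseteq>\<close> of a BE algebra need not be antisymmetric, so the bottom element is not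
  determined by the other operations; it is therefore a parameter of the bounded structure,
  which amounts to carrying the operation \<open>star\<close> in the signature (\<open>\<zero> = star \<one>\<close>).
\<close>

locale bounded_BE_algebra = BE_algebra +
  fixes zero :: 'a  (\<open>\<zero>\<close>)
  assumes zero_le: "\<zero> \<sqsubseteq> x"
begin

definition star :: "'a \<Rightarrow> 'a"
  where "star x = x \<rightarrow> \<zero>"

definition meet_Q :: "'a \<Rightarrow> 'a \<Rightarrow> 'a"  (infixl \<open>\<sqinter>\<^sub>Q\<close> 70)
  where "x \<sqinter>\<^sub>Q y = star ((star x \<rightarrow> star y) \<rightarrow> star y)"

definition le_L :: "'a \<Rightarrow> 'a \<Rightarrow> bool"  (infix \<open>\<sqsubseteq>\<^sub>L\<close> 50)
  where "x \<sqsubseteq>\<^sub>L y \<longleftrightarrow> x = star (x \<rightarrow> star y)"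

end

locale implicative_ortholattice = bounded_BE_algebra +
  assumes involutive: "star (star x) = x"
    and implicative: "(x \<rightarrow> y) \<rightarrow> x = x"
begin

definition Sasaki_set :: "('a \<Rightarrow> 'a) set \<Rightarrow> bool"
  where "Sasaki_set S \<longleftrightarrow>
    (\<forall>\<phi>\<in>S. \<forall>x y. x \<sqsubseteq>\<^sub>L y \<longrightarrow> \<phi> x \<sqsubseteq>\<^sub>L \<phi> y) \<and>
    (\<forall>\<phi>\<in>S. \<forall>\<psi>\<in>S. \<phi> \<one> \<sqsubseteq>\<^sub>L \<psi> \<one> \<longrightarrow> \<phi> \<circ> \<psi> = \<phi>) \<and>
    (\<forall>\<phi>\<in>S. \<forall>x. \<phi> (star (\<phi> x)) \<sqsubseteq>\<^sub>L star x)"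

definition full_Sasaki_set :: "('a \<Rightarrow> 'a) set \<Rightarrow> bool"
  where "full_Sasaki_set S \<longleftrightarrow> Sasaki_set S \<and> (\<forall>x. \<exists>\<phi>\<in>S. \<phi> \<one> = x)"

end

locale implicative_orthomodular_lattice = implicative_ortholattice +
  assumes orthomodular: "x \<sqinter>\<^sub>Q (y \<rightarrow> x) = x"

end

theory Submission
  imports Defs
begin

text \<open>
  An implicative-ortholattice is an ortholattice in disguise: with \<open>x \<squnion> y = star x \<rightarrow> y\<close> and
  \<open>x \<sqinter> y = star (x \<rightarrow> star y)\<close>, the exchange law gives commutativity and associativity, the
  implicative law is absorption, and \<open>\<sqsubseteq>\<^sub>L\<close> is the lattice order. In this language
  \<open>x \<sqinter>\<^sub>Q a = (x \<squnion> star a) \<sqinter> a\<close> is the Sasaki projection of \<open>x\<close> onto \<open>a\<close>. Since every element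
  above \<open>x\<close> has the form \<open>y \<rightarrow> x\<close>, the defining identity of implicative-orthomodular lattices
  says that \<open>(x \<squnion> star z) \<sqinter> z = x\<close> whenever \<open>x \<sqsubseteq>\<^sub>L z\<close>, which is the orthomodular law.

  In an orthomodular lattice the Sasaki projections \<open>\<lambda>x. x \<sqinter>\<^sub>Q a\<close> form a full Sasaki set. The
  reason is that such a projection is left adjoint to the Sasaki hook
  \<open>\<lambda>y. star a \<squnion> (a \<sqinter> y)\<close> (lemma \<open>Sasaki_adjunction\<close>). The composition rule for
  \<open>a \<sqsubseteq>\<^sub>L b\<close> holds because the hook of \<open>a\<close> takes values above \<open>star b\<close>, which the hook of \<open>b\<close> fixes;
  the third condition holds because the hook is, up to orthocomplements, the projection itself.

  Conversely, the third condition makes each member of a Sasaki set self-adjoint for the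
  orthogonality relation \<open>x \<sqsubseteq>\<^sub>L star y\<close> (lemma \<open>Sasaki_set_self_adjoint\<close>). If \<open>\<phi> \<one> = z\<close> then, by
  taking adjoints in the composition rule, \<open>\<phi>\<close> fixes every element below \<open>z\<close>
  (lemma \<open>full_Sasaki_set_fixes_below\<close>). Being a left adjoint that fixes \<open>x\<close> and annihilates \<open>star z\<close>, \<open>\<phi>\<close>
  sends \<open>x \<squnion> star z\<close> below \<open>x\<close> for \<open>x \<sqsubseteq>\<^sub>L z\<close>; and \<open>(x \<squnion> star z) \<sqinter> z\<close>, being fixed by \<open>\<phi>\<close>, lies below the image of \<open>x \<squnion> star z\<close>.
  This is the nontrivial half of the orthomodular law.
\<close>

section \<open>The ortholattice of an implicative-ortholattice\<close>

context implicative_ortholattice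
begin

definition join :: "'a \<Rightarrow> 'a \<Rightarrow> 'a"  (infixl \<open>\<squnion>\<close> 65)
  where "x \<squnion> y = star x \<rightarrow> y"

definition meet :: "'a \<Rightarrow> 'a \<Rightarrow> 'a"  (infixl \<open>\<sqinter>\<close> 70)
  where "x \<sqinter> y = star (x \<rightarrow> star y)"

definition less_L :: "'a \<Rightarrow> 'a \<Rightarrow> bool"  (infix \<open>\<sqsubset>\<^sub>L\<close> 50)
  where "x \<sqsubset>\<^sub>L y \<longleftrightarrow> x \<sqsubseteq>\<^sub>L y \<and> \<not> y \<sqsubseteq>\<^sub>L x"

lemma imp_star_commute: "x \<rightarrow> star y = y \<rightarrow> star x"
  unfolding star_def by (rule imp_exchange)

lemma star_join: "star (x \<squnion> y) = star x \<sqinter> star y"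
  by (simp add: join_def meet_def involutive)

lemma star_meet: "star (x \<sqinter> y) = star x \<squnion> star y"
  by (simp add: join_def meet_def involutive)

lemma imp_eq_join: "x \<rightarrow> y = star x \<squnion> y"
  by (simp add: join_def involutive)

lemma join_commute: "x \<squnion> y = y \<squnion> x"
  unfolding join_def by (metis imp_star_commute involutive)

lemma join_assoc: "(x \<squnion> y) \<squnion> z = x \<squnion> (y \<squnion> z)"
proof -
  have "(x \<squnion> y) \<squnion> z = z \<squnion> (x \<squnion> y)"
    by (rule join_commute)
  also have "\<dots> = x \<squnion> (z \<squnion> y)"
    unfolding join_def by (rule imp_exchange)
  finally show ?thesis
    by (simp add: join_commute)
qed

lemma join_meet_absorb: "x \<squnion> (x \<sqinter> y) = x"
proof -
  have "x \<squnion> (x \<sqinter> y) = (x \<sqinter> y) \<squnion> x"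
    by (rule join_commute)
  also have "\<dots> = (x \<rightarrow> star y) \<rightarrow> x"
    by (simp add: join_def meet_def involutive)
  finally show ?thesis
    by (simp add: implicative)
qed

lemma meet_commute: "x \<sqinter> y = y \<sqinter> x"
  unfolding meet_def by (simp add: imp_star_commute)

lemma meet_assoc: "(x \<sqinter> y) \<sqinter> z = x \<sqinter> (y \<sqinter> z)"
  by (metis involutive join_assoc star_meet)

lemma meet_join_absorb: "x \<sqinter> (x \<squnion> y) = x"
  by (metis involutive join_meet_absorb star_join star_meet)

lemma le_L_iff_meet: "x \<sqsubseteq>\<^sub>L y \<longleftrightarrow> x \<sqinter> y = x"
  unfolding le_L_def meet_def by auto

lemma le_L_iff_join: "x \<sqsubseteq>\<^sub>L y \<longleftrightarrow> x \<squnion> y = y"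
  by (metis join_commute join_meet_absorb le_L_iff_meet meet_commute meet_join_absorb)

lemma meet_idem: "x \<sqinter> x = x"
  by (metis join_meet_absorb meet_join_absorb)

sublocale lat: lattice meet le_L less_L join
proof
  show "x \<sqsubset>\<^sub>L y \<longleftrightarrow> x \<sqsubseteq>\<^sub>L y \<and> \<not> y \<sqsubseteq>\<^sub>L x" for x y
    by (rule less_L_def)
  show "x \<sqsubseteq>\<^sub>L x" for x
    by (simp add: le_L_iff_meet meet_idem)
  show "x \<sqsubseteq>\<^sub>L z" if "x \<sqsubseteq>\<^sub>L y" "y \<sqsubseteq>\<^sub>L z" for x y z
    using that by (metis le_L_iff_meet meet_assoc)
  show "x = y" if "x \<sqsubseteq>\<^sub>L y" "y \<sqsubseteq>\<^sub>L x" for x y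
    using that by (metis le_L_iff_meet meet_commute)
  show "x \<sqinter> y \<sqsubseteq>\<^sub>L x" for x y
    by (metis le_L_iff_meet meet_assoc meet_commute meet_idem)
  show "x \<sqinter> y \<sqsubseteq>\<^sub>L y" for x y
    by (metis le_L_iff_meet meet_assoc meet_idem)
  show "x \<sqsubseteq>\<^sub>L y \<sqinter> z" if "x \<sqsubseteq>\<^sub>L y" "x \<sqsubseteq>\<^sub>L z" for x y z
    using that by (metis le_L_iff_meet meet_assoc)
  show "x \<sqsubseteq>\<^sub>L x \<squnion> y" for x y
    by (simp add: le_L_iff_meet meet_join_absorb)
  show "y \<sqsubseteq>\<^sub>L x \<squnion> y" for x y
    by (metis join_commute le_L_iff_meet meet_join_absorb)
  show "y \<squnion> z \<sqsubseteq>\<^sub>L x" if "y \<sqsubseteq>\<^sub>L x" "z \<sqsubseteq>\<^sub>L x" for x y z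
    using that by (metis join_assoc le_L_iff_join)
qed

lemma star_le_star_iff: "star x \<sqsubseteq>\<^sub>L star y \<longleftrightarrow> y \<sqsubseteq>\<^sub>L x"
  by (metis involutive join_commute le_L_iff_join le_L_iff_meet star_join)

lemma le_star_iff: "x \<sqsubseteq>\<^sub>L star y \<longleftrightarrow> y \<sqsubseteq>\<^sub>L star x"
  by (metis involutive star_le_star_iff)

lemma le_one: "x \<sqsubseteq>\<^sub>L \<one>"
  by (simp add: le_L_iff_join join_def imp_one)

lemma meet_Q_eq: "x \<sqinter>\<^sub>Q a = (x \<squnion> star a) \<sqinter> a"
  by (simp add: meet_Q_def join_def meet_def)

section \<open>A full Sasaki set forces orthomodularity\<close>

text \<open>
  The hypothesis \<open>\<phi> x \<sqsubseteq>\<^sub>L star y\<close> reads \<open>y \<sqsubseteq>\<^sub>L star (\<phi> x)\<close>; applying \<open>\<phi>\<close> and then the third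
  condition of a Sasaki set gives the other side, and the situation is symmetric in \<open>x\<close> and \<open>y\<close>.
\<close>

lemma Sasaki_set_self_adjoint:
  assumes "Sasaki_set S" "\<phi> \<in> S"
  shows "\<phi> x \<sqsubseteq>\<^sub>L star y \<longleftrightarrow> \<phi> y \<sqsubseteq>\<^sub>L star x"
proof -
  have "\<phi> v \<sqsubseteq>\<^sub>L star u" if "\<phi> u \<sqsubseteq>\<^sub>L star v" for u v
  proof -
    have "v \<sqsubseteq>\<^sub>L star (\<phi> u)"
      using that by (simp add: le_star_iff)
    then have "\<phi> v \<sqsubseteq>\<^sub>L \<phi> (star (\<phi> u))"
      using assms unfolding Sasaki_set_def by blast
    also have "\<dots> \<sqsubseteq>\<^sub>L star u"
      using assms unfolding Sasaki_set_def by blast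
    finally show ?thesis .
  qed
  then show ?thesis by blast
qed

text \<open>
  For \<open>\<psi>\<close> with \<open>\<psi> \<one> = x\<close> the composition rule gives \<open>\<psi> \<circ> \<phi> = \<psi>\<close>. Both maps are self-adjoint, so
  passing to adjoints reverses the composite: \<open>\<phi> \<circ> \<psi> = \<psi>\<close>. Evaluating at \<open>\<one>\<close> gives the claim.
\<close>

lemma full_Sasaki_set_fixes_below:
  assumes full: "full_Sasaki_set S" and \<phi>: "\<phi> \<in> S" and x: "x \<sqsubseteq>\<^sub>L \<phi> \<one>"
  shows "\<phi> x = x"
proof -
  have S: "Sasaki_set S"
    using full by (simp add: full_Sasaki_set_def)
  obtain \<psi> where \<psi>: "\<psi> \<in> S" "\<psi> \<one> = x"
    using full unfolding full_Sasaki_set_def by blast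
  have comp: "\<psi> \<circ> \<phi> = \<psi>"
    using S \<phi> \<psi> x unfolding Sasaki_set_def by blast
  have "\<phi> (\<psi> \<one>) \<sqsubseteq>\<^sub>L star v \<longleftrightarrow> \<psi> \<one> \<sqsubseteq>\<^sub>L star v" for v
  proof -
    have "\<phi> (\<psi> \<one>) \<sqsubseteq>\<^sub>L star v \<longleftrightarrow> \<phi> v \<sqsubseteq>\<^sub>L star (\<psi> \<one>)"
      by (rule Sasaki_set_self_adjoint[OF S \<phi>])
    also have "\<dots> \<longleftrightarrow> \<psi> \<one> \<sqsubseteq>\<^sub>L star (\<phi> v)"
      by (rule le_star_iff)
    also have "\<dots> \<longleftrightarrow> \<psi> (\<phi> v) \<sqsubseteq>\<^sub>L star \<one>"
      by (rule Sasaki_set_self_adjoint[OF S \<psi>(1)])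
    also have "\<dots> \<longleftrightarrow> \<psi> v \<sqsubseteq>\<^sub>L star \<one>"
      using fun_cong[OF comp, of v] by simp
    also have "\<dots> \<longleftrightarrow> \<psi> \<one> \<sqsubseteq>\<^sub>L star v"
      by (rule Sasaki_set_self_adjoint[OF S \<psi>(1)])
    finally show ?thesis .
  qed
  then have "\<phi> x \<sqsubseteq>\<^sub>L w \<longleftrightarrow> x \<sqsubseteq>\<^sub>L w" for w
    using \<psi>(2) by (metis involutive)
  then show ?thesis
    by (meson lat.order.antisym lat.order.refl)
qed

lemma full_Sasaki_set_imp_orthomodular:
  assumes full: "full_Sasaki_set S" and le: "x \<sqsubseteq>\<^sub>L z"
  shows "x \<sqinter>\<^sub>Q z = x"
proof -
  have S: "Sasaki_set S"
    using full by (simp add: full_Sasaki_set_def)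
  obtain \<phi> where \<phi>: "\<phi> \<in> S" "\<phi> \<one> = z"
    using full unfolding full_Sasaki_set_def by blast
  have mono: "u \<sqsubseteq>\<^sub>L v \<Longrightarrow> \<phi> u \<sqsubseteq>\<^sub>L \<phi> v" for u v
    using S \<phi> unfolding Sasaki_set_def by blast
  have fixes_below: "u \<sqsubseteq>\<^sub>L z \<Longrightarrow> \<phi> u = u" for u
    using full_Sasaki_set_fixes_below[OF full \<phi>(1)] \<phi>(2) by simp
  have adjoint: "\<phi> w \<sqsubseteq>\<^sub>L x \<longleftrightarrow> w \<sqsubseteq>\<^sub>L star (\<phi> (star x))" for w
    by (metis Sasaki_set_self_adjoint[OF S \<phi>(1)] involutive le_star_iff)
  have "x \<sqsubseteq>\<^sub>L star (\<phi> (star x))"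
    using fixes_below[OF le] by (simp flip: adjoint)
  moreover have "star z \<sqsubseteq>\<^sub>L star (\<phi> (star x))"
    using mono[OF le_one] \<phi>(2) by (simp add: star_le_star_iff)
  ultimately have image: "\<phi> (x \<squnion> star z) \<sqsubseteq>\<^sub>L x"
    by (simp add: adjoint)
  have "(x \<squnion> star z) \<sqinter> z = \<phi> ((x \<squnion> star z) \<sqinter> z)"
    by (simp add: fixes_below)
  also have "\<dots> \<sqsubseteq>\<^sub>L \<phi> (x \<squnion> star z)"
    by (simp add: mono)
  also note image
  finally have "(x \<squnion> star z) \<sqinter> z \<sqsubseteq>\<^sub>L x" .
  moreover have "x \<sqsubseteq>\<^sub>L (x \<squnion> star z) \<sqinter> z"
    using le by simp
  ultimately show ?thesis
    by (simp add: meet_Q_eq lat.order.antisym)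
qed

end

section \<open>Sasaki projections in an implicative-orthomodular lattice\<close>

context implicative_orthomodular_lattice
begin

lemma orthomodular_law:
  assumes "x \<sqsubseteq>\<^sub>L z"
  shows "(x \<squnion> star z) \<sqinter> z = x"
proof -
  have "z = star z \<rightarrow> x"
    using assms by (simp add: imp_eq_join involutive le_L_iff_join join_commute)
  then show ?thesis
    using orthomodular[of x "star z"] by (simp add: meet_Q_eq)
qed

lemma orthomodular_law_dual:
  assumes "x \<sqsubseteq>\<^sub>L z"
  shows "x \<squnion> (star x \<sqinter> z) = z"
proof -
  have "(star z \<squnion> star (star x)) \<sqinter> star x = star z"
    by (rule orthomodular_law) (simp add: assms star_le_star_iff)
  then have "star ((star z \<squnion> x) \<sqinter> star x) = z"
    by (simp add: involutive)
  then show ?thesis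
    by (simp add: star_meet star_join involutive join_commute meet_commute)
qed

text \<open>
  The two composites of projection and hook reduce, by the orthomodular law and its dual, to
  \<open>y \<mapsto> a \<sqinter> y\<close> and \<open>x \<mapsto> x \<squnion> star a\<close>, which lie below and above the identity respectively; these are
  the counit and the unit of the adjunction.
\<close>

lemma Sasaki_adjunction: "x \<sqinter>\<^sub>Q a \<sqsubseteq>\<^sub>L y \<longleftrightarrow> x \<sqsubseteq>\<^sub>L star a \<squnion> (a \<sqinter> y)"
proof
  assume "x \<sqsubseteq>\<^sub>L star a \<squnion> (a \<sqinter> y)"
  then have "(x \<squnion> star a) \<sqinter> a \<sqsubseteq>\<^sub>L ((a \<sqinter> y) \<squnion> star a) \<sqinter> a"
    by (intro lat.inf_mono) (simp_all add: join_commute)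
  also have "\<dots> = a \<sqinter> y"
    by (simp add: orthomodular_law)
  also have "\<dots> \<sqsubseteq>\<^sub>L y"
    by simp
  finally show "x \<sqinter>\<^sub>Q a \<sqsubseteq>\<^sub>L y"
    by (simp add: meet_Q_eq)
next
  assume "x \<sqinter>\<^sub>Q a \<sqsubseteq>\<^sub>L y"
  then have le: "a \<sqinter> (x \<squnion> star a) \<sqsubseteq>\<^sub>L a \<sqinter> y"
    by (simp add: meet_Q_eq meet_commute)
  have "x \<sqsubseteq>\<^sub>L x \<squnion> star a"
    by simp
  also have "\<dots> = star a \<squnion> (star (star a) \<sqinter> (x \<squnion> star a))"
    by (simp add: orthomodular_law_dual)
  also have "\<dots> \<sqsubseteq>\<^sub>L star a \<squnion> (a \<sqinter> y)"
    unfolding involutive using le by (intro lat.sup_mono) simp_all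
  finally show "x \<sqsubseteq>\<^sub>L star a \<squnion> (a \<sqinter> y)" .
qed

lemma one_meet_Q: "\<one> \<sqinter>\<^sub>Q a = a"
proof -
  have "\<one> \<squnion> star a = \<one>"
    using le_one[of "star a"] by (simp add: le_L_iff_join join_commute)
  then show ?thesis
    using le_one[of a] by (simp add: meet_Q_eq le_L_iff_meet meet_commute)
qed

lemma meet_Q_mono: "x \<sqsubseteq>\<^sub>L y \<Longrightarrow> x \<sqinter>\<^sub>Q a \<sqsubseteq>\<^sub>L y \<sqinter>\<^sub>Q a"
  unfolding meet_Q_eq by (intro lat.inf_mono lat.sup_mono) simp_all

text \<open>
  It suffices to compare the right adjoints, which compose in the opposite order. The hook of \<open>a\<close>
  takes values above \<open>star a\<close>, hence above \<open>star b\<close>, and there the hook of \<open>b\<close> is the identity by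
  the dual orthomodular law.
\<close>

lemma meet_Q_absorb:
  assumes "a \<sqsubseteq>\<^sub>L b"
  shows "(x \<sqinter>\<^sub>Q b) \<sqinter>\<^sub>Q a = x \<sqinter>\<^sub>Q a"
proof -
  have "(x \<sqinter>\<^sub>Q b) \<sqinter>\<^sub>Q a \<sqsubseteq>\<^sub>L y \<longleftrightarrow> x \<sqinter>\<^sub>Q a \<sqsubseteq>\<^sub>L y" for y
  proof -
    let ?h = "star a \<squnion> (a \<sqinter> y)"
    have "star b \<sqsubseteq>\<^sub>L ?h"
      using assms by (meson lat.le_supI1 star_le_star_iff)
    then have "star b \<squnion> (b \<sqinter> ?h) = ?h"
      using orthomodular_law_dual[of "star b" ?h] by (simp add: involutive)
    then show ?thesis
      by (simp add: Sasaki_adjunction)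
  qed
  then show ?thesis
    by (meson lat.order.antisym lat.order.refl)
qed

text \<open>
  By the adjunction the claim compares \<open>star (x \<sqinter>\<^sub>Q a)\<close> with the hook of \<open>a\<close> at \<open>star x\<close>, and the
  De Morgan laws make these two elements equal.
\<close>

lemma meet_Q_star_meet_Q: "star (x \<sqinter>\<^sub>Q a) \<sqinter>\<^sub>Q a \<sqsubseteq>\<^sub>L star x"
proof -
  have "star (x \<sqinter>\<^sub>Q a) = star a \<squnion> (a \<sqinter> star x)"
    by (simp add: meet_Q_eq star_meet star_join involutive join_commute meet_commute)
  then show ?thesis
    by (simp add: Sasaki_adjunction)
qed

lemma full_Sasaki_set_projections: "full_Sasaki_set (range (\<lambda>a x. x \<sqinter>\<^sub>Q a))"
  unfolding full_Sasaki_set_def Sasaki_set_def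
  by (auto simp: one_meet_Q meet_Q_mono meet_Q_absorb meet_Q_star_meet_Q fun_eq_iff)

end

section \<open>The characterization\<close>

theorem theorem6p9:
  fixes imp :: "'a \<Rightarrow> 'a \<Rightarrow> 'a" and one zero :: 'a
  assumes "implicative_ortholattice imp one zero"
  shows "implicative_orthomodular_lattice imp one zero \<longleftrightarrow>
    (\<exists>S. implicative_ortholattice.full_Sasaki_set imp one zero S)"
proof
  assume "implicative_orthomodular_lattice imp one zero"
  then show "\<exists>S. implicative_ortholattice.full_Sasaki_set imp one zero S"
    by (intro exI) (rule implicative_orthomodular_lattice.full_Sasaki_set_projections)
next
  interpret implicative_ortholattice imp one zero
    by (rule assms)
  assume "\<exists>S. full_Sasaki_set S"
  then obtain S where S: "full_Sasaki_set S" ..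
  show "implicative_orthomodular_lattice imp one zero"
  proof
    fix x y
    have "x \<sqsubseteq>\<^sub>L imp y x"
      by (simp add: imp_eq_join)
    then show "x \<sqinter>\<^sub>Q imp y x = x"
      by (rule full_Sasaki_set_imp_orthomodular[OF S])
  qed
qed

end
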